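(* There exists a universal constant $C>0$ such that for every $n\in\mathbb{N}$ and every $t\in[0,1-n^{-1/3}]$, with $p=1-e^{-t/n}$, both of the following hold: $$\left|\,\mathbb{E}_{n,p}(|\mathcal{C}|)-\frac{1}{1-t}-\frac{\frac{t^2}{2}-t}{(1-t)^4}\,\frac{1}{n}\,\right|\le \frac{C}{(1-t)^7 n^2},$$ $$\left|\,\mathbb{E}_{n,p}(|\mathcal{C}|^2)-\frac{1}{(1-t)^3}\,\right|\le \frac{C}{(1-t)^6 n}.$$
   Context: $\mathbb{N}=\{1,2,3,\dots\}$. $\mathcal{G}_{n,p}$ is the Erdős–Rényi random graph on the vertex set $\{1,\dots,n\}$ in which each unordered pair of distinct vertices is joined by an edge with probability $p$, independently of all other pairs. $\mathbb{E}_{n,p}$ denotes expectation with respect to its law. $\mathcal{C}$ is the connected component of the vertex $1$, and $|\mathcal{C}|$ is its number of vertices. *)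

theory Defs
  imports "HOL-Probability.Probability" "HOL-Probability.Product_PMF"
begin

definition vertex_pairs :: "nat \<Rightarrow> nat set set" where
  "vertex_pairs n = {e. e \<subseteq> {1..n} \<and> card e = 2}"

text \<open>A graph on the vertex set \<open>{1..n}\<close> is represented by its edge set, a subset of
  \<^term>\<open>vertex_pairs n\<close>. The random graph is read off from independent Bernoulli indicators,
  one per unordered pair; \<^const>\<open>bernoulli_pmf\<close> has parameter \<open>p\<close> only for \<open>0 \<le> p \<le> 1\<close>.\<close>

definition erdos_renyi :: "nat \<Rightarrow> real \<Rightarrow> nat set set pmf" where
  "erdos_renyi n p =
     map_pmf (\<lambda>X. {e \<in> vertex_pairs n. X e})
       (Pi_pmf (vertex_pairs n) False (\<lambda>_. bernoulli_pmf p))"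

definition adjacency :: "nat set set \<Rightarrow> (nat \<times> nat) set" where
  "adjacency E = {(u, v). {u, v} \<in> E}"

definition component :: "nat \<Rightarrow> nat set set \<Rightarrow> nat \<Rightarrow> nat set" where
  "component n E v = {w \<in> {1..n}. (v, w) \<in> (adjacency E)\<^sup>*}"

end

theory Submission
  imports Defs
begin

text \<open>
  Fix a set \<open>J\<close> of \<open>j\<close> vertices other than \<open>1\<close>, and let \<open>q = 1 - p = exp (- t / n)\<close>. Deleting \<open>J\<close>
  leaves a random graph whose component of \<open>1\<close> equals \<open>A\<close> with probability
  \<open>P(C = A) / q ^ (j * card A)\<close>, since the edges between \<open>A\<close> and \<open>J\<close> are independent of the rest.
  Summing over \<open>A\<close> and then over \<open>J\<close> gives, with \<open>K = |C|\<close>, the exact identities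
  \<open>E((n - K choose j) * exp (j * t * K / n)) = (n - 1 choose j)\<close>.

  In terms of \<open>X = K / n\<close>, \<open>u = exp (t * X)\<close>, \<open>g = (1 - X) * u\<close>, \<open>\<epsilon> = 1 / n\<close> they prescribe the
  expectations of the polynomials \<open>P j = \<Prod>i<j. (g - i * \<epsilon> * u)\<close>. Expanding the powers of \<open>h = 1 - g\<close>
  in the \<open>P j\<close>, all low orders in \<open>\<epsilon>\<close> cancel, and as \<open>h \<ge> (1 - t) * X\<close>, the cases \<open>j \<le> 4\<close> yield
  \<open>E(K ^ j) = O((1 - t) ^ (1 - 2 * j))\<close>. With these bounds, Taylor expansion of the two identities for
  \<open>E h\<close> and \<open>E(h\<^sup>2)\<close> in powers of \<open>X\<close> becomes a linear system for \<open>E K\<close> and \<open>E(K\<^sup>2)\<close> with controlled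
  errors.
\<close>

section \<open>Deleting vertices from the random graph\<close>

lemma finite_vertex_pairs [simp]: "finite (vertex_pairs n)"
  unfolding vertex_pairs_def by (rule finite_subset[of _ "Pow {1..n}"]) auto

lemma component_subset: "component n E v \<subseteq> {1..n}"
  by (auto simp: component_def)

lemma finite_component [simp]: "finite (component n E v)"
  by (rule finite_subset[OF component_subset]) simp

lemma self_in_component: "v \<in> {1..n} \<Longrightarrow> v \<in> component n E v"
  by (simp add: component_def)

lemma component_mono: "E \<subseteq> F \<Longrightarrow> component n E v \<subseteq> component n F v"
  unfolding component_def adjacency_def by (auto intro: rtrancl_mono[THEN subsetD, rotated])

lemma component_step:
  assumes "E \<subseteq> vertex_pairs n" "u \<in> component n E v" "{u, w} \<in> E"
  shows "w \<in> component n E v"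
  using assms unfolding component_def adjacency_def vertex_pairs_def
  by (auto intro: rtrancl_into_rtrancl)

lemma component_eqI:
  assumes "v \<in> A" "A \<subseteq> component n E v" "\<And>u w. u \<in> A \<Longrightarrow> {u, w} \<in> E \<Longrightarrow> w \<in> A"
  shows "component n E v = A"
proof -
  have "w \<in> A" if "(v, w) \<in> (adjacency E)\<^sup>*" for w
    using that by induction (use assms(1,3) in \<open>auto simp: adjacency_def\<close>)
  with assms(2) show ?thesis by (auto simp: component_def)
qed

text \<open>If no edge of \<open>E\<close> joins \<open>A\<close> to \<open>J\<close>, then
  \<open>A\<close> is closed under the edges of \<open>E\<close> and is therefore the whole
  component; conversely \<open>A\<close> always lies in the component. Hence avoidance of
  \<open>J\<close> is decided by \<open>A\<close>, which the edges off \<open>J\<close> determine,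
  and by the edges between \<open>A\<close> and \<open>J\<close>.\<close>

lemma component_avoiding:
  assumes E: "E \<subseteq> vertex_pairs n" and v: "v \<in> {1..n}" "v \<notin> J"
  defines "A \<equiv> component n {e \<in> E. e \<inter> J = {}} v"
  shows "A \<inter> J = {}"
    and "component n E v \<inter> J = {} \<longleftrightarrow> (\<forall>a\<in>A. \<forall>b\<in>J. {a, b} \<notin> E)"
    and "component n E v \<inter> J = {} \<Longrightarrow> component n E v = A"
proof -
  have vA: "v \<in> A" using v by (simp add: A_def self_in_component)
  have sub: "A \<subseteq> component n E v"
    unfolding A_def by (rule component_mono) auto
  have "w \<notin> J" if "(v, w) \<in> (adjacency {e \<in> E. e \<inter> J = {}})\<^sup>*" for w
    using that by induction (use v in \<open>auto simp: adjacency_def\<close>)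
  then show disj: "A \<inter> J = {}"
    by (auto simp: A_def component_def)
  have eq: "component n E v = A" if "\<forall>a\<in>A. \<forall>b\<in>J. {a, b} \<notin> E"
  proof (rule component_eqI[OF vA sub])
    fix u w assume u: "u \<in> A" and uw: "{u, w} \<in> E"
    have "{u, w} \<in> {e \<in> E. e \<inter> J = {}}" using that u uw disj by auto
    with u show "w \<in> A"
      unfolding A_def by (rule component_step[rotated]) (use E in auto)
  qed
  show iff: "component n E v \<inter> J = {} \<longleftrightarrow> (\<forall>a\<in>A. \<forall>b\<in>J. {a, b} \<notin> E)"
    using eq disj sub component_step[OF E] by blast
  show "component n E v \<inter> J = {} \<Longrightarrow> component n E v = A"
    using iff eq by blast
qed

section \<open>Expectations over independent edge indicators\<close>

lemma expectation_bind_finite: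
  fixes h :: "'b \<Rightarrow> real"
  assumes "finite (set_pmf M)" "\<And>x. x \<in> set_pmf M \<Longrightarrow> finite (set_pmf (N x))"
  shows "measure_pmf.expectation (M \<bind> N) h =
    measure_pmf.expectation M (\<lambda>x. measure_pmf.expectation (N x) h)"
  using assms
  by (subst pmf_expectation_bind[of "set_pmf M"])
     (auto simp: integral_measure_pmf[of "set_pmf M"])

lemma finite_set_Pi_pmf_bool [simp]:
  fixes P :: "'a \<Rightarrow> bool pmf"
  shows "finite B \<Longrightarrow> finite (set_pmf (Pi_pmf B d P))"
  by (rule finite_subset[OF set_Pi_pmf_subset']) auto

text \<open>Both \<open>\<phi>\<close> and \<open>S\<close> see only the coordinates in
  \<open>B\<close>. Once these are fixed, the coordinates in \<open>S X\<close>, which all lie in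
  \<open>D\<close>, are still independent and vanish together with probability
  \<open>(1 - p) ^ card (S X)\<close>.\<close>

lemma expectation_Pi_bernoulli_avoid:
  fixes \<phi> :: "('a \<Rightarrow> bool) \<Rightarrow> real"
  assumes fin: "finite B" "finite D" and disj: "B \<inter> D = {}" and p: "0 \<le> p" "p \<le> 1"
    and S: "\<And>X. S X \<subseteq> D"
  shows "measure_pmf.expectation (Pi_pmf (B \<union> D) False (\<lambda>_. bernoulli_pmf p))
      (\<lambda>X. \<phi> (\<lambda>e. e \<in> B \<and> X e) * of_bool (\<forall>e \<in> S (\<lambda>e. e \<in> B \<and> X e). \<not> X e)) =
    measure_pmf.expectation (Pi_pmf B False (\<lambda>_. bernoulli_pmf p))
      (\<lambda>X. \<phi> X * (1 - p) ^ card (S X))"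
proof -
  let ?P = "\<lambda>B. Pi_pmf B False (\<lambda>_. bernoulli_pmf p)"
  let ?f = "\<lambda>X. \<phi> (\<lambda>e. e \<in> B \<and> X e) * of_bool (\<forall>e \<in> S (\<lambda>e. e \<in> B \<and> X e). \<not> X e)"
  let ?h = "\<lambda>f g x. if x \<in> B then f x else g x"
  have "?P (B \<union> D) = ?P B \<bind> (\<lambda>f. map_pmf (?h f) (?P D))"
    using fin disj
    by (simp add: Pi_pmf_union pair_pmf_def map_bind_pmf map_pmf_def bind_assoc_pmf bind_return_pmf)
  then have "measure_pmf.expectation (?P (B \<union> D)) ?f =
      measure_pmf.expectation (?P B) (\<lambda>X. measure_pmf.expectation (?P D) (\<lambda>g. ?f (?h X g)))"
    by (simp add: expectation_bind_finite fin)
  also have "\<dots> = measure_pmf.expectation (?P B) (\<lambda>X. \<phi> X * (1 - p) ^ card (S X))"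
  proof (intro integral_cong_AE AE_pmfI)
    fix X assume "X \<in> set_pmf (?P B)"
    then have X: "(\<lambda>e. e \<in> B \<and> X e) = X"
      using set_Pi_pmf_subset[OF fin(1), of False "\<lambda>_. bernoulli_pmf p"] by fastforce
    have "(\<lambda>e. e \<in> B \<and> ?h X g e) = X" for g
      using X by (auto simp: fun_eq_iff)
    then have "measure_pmf.expectation (?P D) (\<lambda>g. ?f (?h X g)) =
        measure_pmf.expectation (?P D) (\<lambda>g. \<phi> X * of_bool (\<forall>e\<in>S X. \<not> g e))"
      using S[of X] disj by (intro Bochner_Integration.integral_cong) auto
    also have "\<dots> = \<phi> X * measure_pmf.expectation (?P D)
        (indicator (Pi D (\<lambda>e. if e \<in> S X then {False} else UNIV)))"
    proof -
      \<comment> \<open>The event is written as a box over \<open>D\<close>, with the full factor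
        \<open>UNIV\<close> outside \<open>S X\<close>, so that its probability is a
        product.\<close>
      have *: "(\<lambda>g. of_bool (\<forall>e\<in>S X. \<not> g e)) = indicat_real (Pi D (\<lambda>e. if e \<in> S X then {False} else UNIV))"
        using S[of X] by (auto simp: fun_eq_iff indicator_def Pi_def split: if_splits)
      show ?thesis by (simp only: integral_mult_right_zero flip: *)
    qed
    also have "\<dots> = \<phi> X * (\<Prod>e\<in>D. measure_pmf.prob (bernoulli_pmf p) (if e \<in> S X then {False} else UNIV))"
      using fin by (simp add: measure_Pi_pmf_Pi)
    also have "(\<Prod>e\<in>D. measure_pmf.prob (bernoulli_pmf p) (if e \<in> S X then {False} else UNIV))
        = (\<Prod>e\<in>D. if e \<in> S X then 1 - p else 1)"
      using p by (intro prod.cong) (auto simp: measure_pmf_single)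
    also have "\<dots> = (1 - p) ^ card (S X)"
      using fin S[of X] by (simp add: prod.If_cases Int_absorb1)
    finally show "measure_pmf.expectation (?P D) (\<lambda>g. ?f (?h X g)) = \<phi> X * (1 - p) ^ card (S X)" .
  qed auto
  finally show ?thesis .
qed

text \<open>\<open>S X\<close> consists of the pairs joining the reduced component
  \<open>A X\<close> to \<open>J\<close>. There are \<open>card J * card (A X)\<close> of them, so
  the probability that all are absent cancels the weight exactly, whatever \<open>A X\<close>
  is.\<close>

lemma expectation_erdos_renyi_avoid:
  assumes n: "n \<ge> 1" and J: "J \<subseteq> {2..n}" and p: "0 \<le> p" "p < 1"
  shows "measure_pmf.expectation (erdos_renyi n p)
      (\<lambda>E. of_bool (component n E 1 \<inter> J = {}) / (1 - p) ^ (card J * card (component n E 1))) = 1"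
proof -
  define B where "B = {e \<in> vertex_pairs n. e \<inter> J = {}}"
  define D where "D = {e \<in> vertex_pairs n. e \<inter> J \<noteq> {}}"
  have fin: "finite B" "finite D" "finite J" and disj: "B \<inter> D = {}" and BD: "vertex_pairs n = B \<union> D"
    using J by (auto simp: B_def D_def intro: finite_subset)
  define A where "A X = component n {e \<in> B. X e} 1" for X
  define S where "S X = (\<lambda>(a, b). {a, b}) ` (A X \<times> J)" for X
  define \<phi> :: "(nat set \<Rightarrow> bool) \<Rightarrow> real" where "\<phi> X = 1 / (1 - p) ^ (card J * card (A X))" for X
  have AJ: "A X \<inter> J = {}" for X
  proof -
    have "{e \<in> {e \<in> B. X e}. e \<inter> J = {}} = {e \<in> B. X e}" by (auto simp: B_def)
    moreover have "1 \<in> {1..n}" "1 \<notin> J" using n J by auto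
    ultimately show ?thesis
      using component_avoiding(1)[of "{e \<in> B. X e}" n 1 J] by (auto simp: A_def B_def)
  qed
  have SD: "S X \<subseteq> D" for X
  proof -
    have "{a, b} \<in> D" if "a \<in> A X" "b \<in> J" for a b
    proof -
      have "a \<in> {1..n}" using that component_subset by (auto simp only: A_def)
      then show ?thesis using that AJ[of X] J by (auto simp: D_def vertex_pairs_def card_insert_if)
    qed
    then show ?thesis by (auto simp: S_def)
  qed
  have cardS: "card (S X) = card J * card (A X)" for X
  proof -
    have "inj_on (\<lambda>(a, b). {a, b}) (A X \<times> J)"
      using AJ[of X] by (auto simp: inj_on_def doubleton_eq_iff)
    then show ?thesis by (simp add: S_def card_image card_cartesian_product mult.commute)
  qed
  \<comment> \<open>If the component avoids \<open>J\<close>, it equals the reduced component, so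
    the weight depends on the edges in \<open>B\<close> only; otherwise both sides are 0.\<close>
  have eq: "of_bool (component n {e \<in> B \<union> D. X e} 1 \<inter> J = {}) /
        (1 - p) ^ (card J * card (component n {e \<in> B \<union> D. X e} 1)) =
      \<phi> (\<lambda>e. e \<in> B \<and> X e) * of_bool (\<forall>e \<in> S (\<lambda>e. e \<in> B \<and> X e). \<not> X e)" for X
  proof -
    have *: "{e \<in> {e \<in> B \<union> D. X e}. e \<inter> J = {}} = {e \<in> B. X e}"
      by (auto simp: B_def D_def)
    have **: "{e \<in> B. e \<in> B \<and> X e} = {e \<in> B. X e}" by auto
    have sub: "{e \<in> B \<union> D. X e} \<subseteq> vertex_pairs n" using BD by auto
    have J1: "(1::nat) \<in> {1..n}" "1 \<notin> J" using n J by auto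
    note ca = component_avoiding(2,3)[OF sub J1, unfolded *]
    have "(\<forall>e \<in> S (\<lambda>e. e \<in> B \<and> X e). \<not> X e) \<longleftrightarrow> component n {e \<in> B \<union> D. X e} 1 \<inter> J = {}"
      unfolding ca(1) using SD[of "\<lambda>e. e \<in> B \<and> X e"] by (auto simp: S_def A_def)
    then show ?thesis
      using ca(2) by (auto simp: \<phi>_def A_def)
  qed
  have "measure_pmf.expectation (erdos_renyi n p)
      (\<lambda>E. of_bool (component n E 1 \<inter> J = {}) / (1 - p) ^ (card J * card (component n E 1))) =
    measure_pmf.expectation (Pi_pmf (B \<union> D) False (\<lambda>_. bernoulli_pmf p))
      (\<lambda>X. \<phi> (\<lambda>e. e \<in> B \<and> X e) * of_bool (\<forall>e \<in> S (\<lambda>e. e \<in> B \<and> X e). \<not> X e))"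
    unfolding erdos_renyi_def BD by (simp only: integral_map_pmf eq)
  also have "\<dots> = measure_pmf.expectation (Pi_pmf B False (\<lambda>_. bernoulli_pmf p))
      (\<lambda>X. \<phi> X * (1 - p) ^ card (S X))"
    by (rule expectation_Pi_bernoulli_avoid) (use fin disj p SD in auto)
  also have "\<dots> = 1"
    using p by (simp add: \<phi>_def cardS)
  finally show ?thesis .
qed

text \<open>The preceding identity is summed over all \<open>J\<close> of size \<open>j\<close>.
  Since 1 lies in the component, the sets \<open>J\<close> avoiding it are exactly the subsets of
  size \<open>j\<close> of its complement in \<open>{1..n}\<close>.\<close>

lemma expectation_erdos_renyi_choose:
  assumes n: "n \<ge> 1" and p: "0 \<le> p" "p < 1"
  shows "measure_pmf.expectation (erdos_renyi n p)
      (\<lambda>E. real ((n - card (component n E 1)) choose j) / (1 - p) ^ (j * card (component n E 1))) =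
    real ((n - 1) choose j)"
proof -
  let ?\<J> = "{J. J \<subseteq> {2..n} \<and> card J = j}"
  let ?f = "\<lambda>J E. of_bool (component n E 1 \<inter> J = {}) / (1 - p) ^ (card J * card (component n E 1))"
  have fin: "finite ?\<J>" by (rule finite_subset[of _ "Pow {2..n}"]) auto
  have "finite (set_pmf (erdos_renyi n p))" by (simp add: erdos_renyi_def)
  note int = integrable_measure_pmf_finite[OF this]
  have eq: "real ((n - card (component n E 1)) choose j) / (1 - p) ^ (j * card (component n E 1)) =
    (\<Sum>J\<in>?\<J>. ?f J E)" for E
  proof -
    let ?C = "component n E 1"
    have "(\<Sum>J\<in>?\<J>. ?f J E) = (\<Sum>J\<in>?\<J>. of_bool (?C \<inter> J = {})) / (1 - p) ^ (j * card ?C)"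
      unfolding sum_divide_distrib by (intro sum.cong) auto
    also have "(\<Sum>J\<in>?\<J>. of_bool (?C \<inter> J = {}) :: real) = real (card (?\<J> \<inter> {J. ?C \<inter> J = {}}))"
      using fin by (simp add: sum_of_bool_eq)
    also have "?\<J> \<inter> {J. ?C \<inter> J = {}} = {J. J \<subseteq> {1..n} - ?C \<and> card J = j}"
    proof -
      have "{2..n} = {1..n} - {1}" by auto
      then show ?thesis using self_in_component[of 1 n E] n by auto
    qed
    also have "card \<dots> = (n - card ?C) choose j"
      using component_subset[of n E 1] by (simp add: n_subsets card_Diff_subset)
    finally show ?thesis by simp
  qed
  have "measure_pmf.expectation (erdos_renyi n p) (\<lambda>E. \<Sum>J\<in>?\<J>. ?f J E) =
      (\<Sum>J\<in>?\<J>. measure_pmf.expectation (erdos_renyi n p) (?f J))"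
    by (rule Bochner_Integration.integral_sum) (rule int)
  also have "\<dots> = (\<Sum>J\<in>?\<J>. 1)"
    by (intro sum.cong refl expectation_erdos_renyi_avoid) (use n p in auto)
  also have "\<dots> = real ((n - 1) choose j)"
    by (simp add: n_subsets)
  finally show ?thesis by (simp only: eq)
qed

section \<open>Moments of the component size\<close>

lemma exp_le_linear: "exp y \<le> 1 + y * exp y" for y :: real
proof -
  have "(1 - y) * exp y \<le> exp (- y) * exp y"
    using exp_ge_add_one_self[of "- y"] by (intro mult_right_mono) auto
  then show ?thesis by (simp add: algebra_simps flip: exp_add)
qed

lemma exp_le_quadratic:
  fixes y :: real
  assumes "0 \<le> y"
  shows "exp y \<le> 1 + y + y\<^sup>2 * exp y"
proof -
  have "y * exp y \<le> y * (1 + y * exp y)"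
    using assms exp_le_linear by (intro mult_left_mono)
  then show ?thesis
    using exp_le_linear[of y] by (simp add: algebra_simps power2_eq_square)
qed

text \<open>The difference of the two sides vanishes at 0, and its derivative is nonnegative because
  \<open>exp z <= 1 + z + z^2\<close> on the unit interval.\<close>

lemma exp_le_cubic:
  fixes y :: real
  assumes "0 \<le> y" "y \<le> 1"
  shows "exp y \<le> 1 + y + y\<^sup>2 / 2 + y ^ 3 / 2"
proof -
  let ?f = "\<lambda>y::real. 1 + y + y\<^sup>2 / 2 + y ^ 3 / 2 - exp y"
  have "?f 0 \<le> ?f y"
  proof (rule DERIV_nonneg_imp_nondecreasing[OF assms(1)])
    fix z assume z: "0 \<le> z" "z \<le> y"
    have "(?f has_real_derivative (1 + z + 3 * z\<^sup>2 / 2 - exp z)) (at z)"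
      by (auto intro!: derivative_eq_intros simp: power2_eq_square)
    moreover have "exp z \<le> 1 + z + z\<^sup>2"
      using z assms by (intro exp_bound) auto
    then have "0 \<le> 1 + z + 3 * z\<^sup>2 / 2 - exp z"
      using zero_le_power2[of z] by linarith
    ultimately show "\<exists>d. (?f has_real_derivative d) (at z) \<and> 0 \<le> d" by blast
  qed
  then show ?thesis by simp
qed

section \<open>Exact identities for the law of the component size\<close>

lemma prod_eq_choose:
  assumes "n \<ge> 1" "m \<le> n"
  shows "(\<Prod>i<j. 1 - real m / real n - real i / real n) =
    real ((n - m) choose j) * (fact j / real n ^ j)"
proof -
  have "real ((n - m) choose j) * fact j = (\<Prod>i<j. real n - real m - real i)"
    using assms by (simp add: binomial_gbinomial gbinomial_prod_rev of_nat_diff atLeast0LessThan)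
  moreover have "(\<Prod>i<j. 1 - real m / real n - real i / real n) =
      (\<Prod>i<j. (real n - real m - real i) / real n)"
    using assms by (intro prod.cong) (auto simp: field_simps)
  ultimately show ?thesis by (simp add: prod_dividef)
qed

text \<open>Only the support of the law of the component size and the binomial identities are
  retained; everything about its moments follows from these. The factor
  \<open>exp (t * real k / real n) ^ j\<close> is the inverse of
  \<open>(1 - p) ^ (j * k)\<close>.\<close>

locale component_size_law =
  fixes M :: "nat pmf" and n :: nat and t :: real
  assumes n: "n \<ge> 1" and t: "0 \<le> t" "t < 1"
    and support: "set_pmf M \<subseteq> {1..n}"
    and expectation_choose: "\<And>j. measure_pmf.expectation M
      (\<lambda>k. real ((n - k) choose j) * exp (t * real k / real n) ^ j) = real ((n - 1) choose j)"
begin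

abbreviation "E \<equiv> measure_pmf.expectation M"

definition "\<epsilon> = 1 / real n"
definition "s = 1 - t"
definition "x k = real k / real n"
definition "u k = exp (t * x k)"
definition "g k = (1 - x k) * u k"
definition "h k = 1 - g k"
text \<open>Expanding the \<open>P i\<close> produces factors \<open>g * u ^ j\<close>. Subtracting
  their value 1 at \<open>x k = 0\<close> leaves corrections of order \<open>x k\<close>.\<close>

definition "q j k = g k * u k ^ j - 1"
text \<open>For \<open>k <= n\<close> this is the falling factorial of \<open>n - k\<close> of
  length \<open>j\<close>, scaled by \<open>u k ^ j / n ^ j\<close>, so that the binomial identity
  gives its mean.\<close>

definition "P j k = (\<Prod>i<j. g k - real i * \<epsilon> * u k)"

lemma integrable_law [simp]: "integrable M f" for f :: "nat \<Rightarrow> real"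
  using support by (intro integrable_measure_pmf_finite) (auto intro: finite_subset)

lemma E_mono: "(\<And>k. k \<in> {1..n} \<Longrightarrow> f k \<le> f' k) \<Longrightarrow> E f \<le> E f'" for f f' :: "nat \<Rightarrow> real"
  using support by (intro integral_mono_AE) (auto intro!: AE_pmfI)

lemma E_nonneg: "(\<And>k. k \<in> {1..n} \<Longrightarrow> 0 \<le> f k) \<Longrightarrow> 0 \<le> E f" for f :: "nat \<Rightarrow> real"
  using support by (intro integral_nonneg_AE) (auto intro!: AE_pmfI)

lemma \<epsilon>_bounds: "0 < \<epsilon>" "\<epsilon> \<le> 1"
  using n by (auto simp: \<epsilon>_def)

lemma s_bounds: "0 < s" "s \<le> 1"
  using t by (auto simp: s_def)

lemma x_bounds: "k \<in> {1..n} \<Longrightarrow> 0 \<le> x k" "k \<in> {1..n} \<Longrightarrow> x k \<le> 1"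
  by (auto simp: x_def)

lemma E_P: "E (P j) = (\<Prod>i<j. 1 - real (Suc i) * \<epsilon>)"
proof -
  have "E (P j) = E (\<lambda>k. real ((n - k) choose j) * exp (t * real k / real n) ^ j * (fact j / real n ^ j))"
  proof (intro integral_cong_AE AE_pmfI)
    fix k assume "k \<in> set_pmf M"
    then have "k \<le> n" using support by auto
    have "P j k = (\<Prod>i<j. u k * (1 - real k / real n - real i / real n))"
      by (simp add: P_def g_def x_def \<epsilon>_def algebra_simps)
    also have "\<dots> = u k ^ j * (\<Prod>i<j. 1 - real k / real n - real i / real n)"
      by (simp add: prod.distrib)
    finally have "P j k = u k ^ j * (\<Prod>i<j. 1 - real k / real n - real i / real n)" .
    then show "P j k = real ((n - k) choose j) * exp (t * real k / real n) ^ j * (fact j / real n ^ j)"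
      by (simp add: prod_eq_choose[OF n \<open>k \<le> n\<close>] u_def x_def)
  qed auto
  also have "\<dots> = real ((n - 1) choose j) * (fact j / real n ^ j)"
    by (simp add: expectation_choose)
  also have "\<dots> = (\<Prod>i<j. 1 - real 1 / real n - real i / real n)"
    by (rule prod_eq_choose[symmetric]) (use n in auto)
  also have "\<dots> = (\<Prod>i<j. 1 - real (Suc i) * \<epsilon>)"
    by (intro prod.cong) (auto simp: \<epsilon>_def add_divide_distrib)
  finally show ?thesis .
qed

lemma E_h: "E h = \<epsilon>"
proof -
  have "h = (\<lambda>k. 1 - P 1 k)"
    by (auto simp: h_def P_def)
  then have "E h = E (\<lambda>k. 1 - P 1 k)" by simp
  then show ?thesis by (simp add: E_P)
qed

text \<open>Substitute \<open>g ^ 2 = P 2 + \<epsilon> * g * u\<close>. After taking means, the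
  orders 0 and 1 in \<epsilon> cancel up to the correction \<open>q 1\<close>, leaving the constant
  2!. The third and fourth powers work alike, with constants 3! and 4!.\<close>

lemma E_h2: "E (\<lambda>k. h k ^ 2) = 2 * \<epsilon>\<^sup>2 + \<epsilon> * E (q 1)"
proof -
  have "(\<lambda>k. h k ^ 2) = (\<lambda>k. 1 - 2 * P 1 k + P 2 k + \<epsilon> + \<epsilon> * q 1 k)"
    by (simp add: fun_eq_iff h_def P_def q_def numeral_eq_Suc algebra_simps)
  then have "E (\<lambda>k. h k ^ 2) = E (\<lambda>k. 1 - 2 * P 1 k + P 2 k + \<epsilon> + \<epsilon> * q 1 k)" by simp
  also have "\<dots> = 2 * \<epsilon>\<^sup>2 + \<epsilon> * E (q 1)"
    by (simp add: E_P) (simp add: numeral_eq_Suc algebra_simps)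
  finally show ?thesis .
qed

lemma E_h3: "E (\<lambda>k. h k ^ 3) = 6 * \<epsilon> ^ 3 + 3 * \<epsilon> * E (\<lambda>k. q 1 k * h k) + 2 * \<epsilon>\<^sup>2 * E (q 2)"
proof -
  have "(\<lambda>k. h k ^ 3) = (\<lambda>k. 1 - 3 * P 1 k + 3 * P 2 k - P 3 k + 3 * \<epsilon> * (q 1 k * h k) + 3 * \<epsilon> * h k
      + 2 * \<epsilon>\<^sup>2 * q 2 k + 2 * \<epsilon>\<^sup>2)"
    by (simp add: fun_eq_iff h_def P_def q_def numeral_eq_Suc algebra_simps)
  then have "E (\<lambda>k. h k ^ 3) = E (\<lambda>k. 1 - 3 * P 1 k + 3 * P 2 k - P 3 k + 3 * \<epsilon> * (q 1 k * h k)
      + 3 * \<epsilon> * h k + 2 * \<epsilon>\<^sup>2 * q 2 k + 2 * \<epsilon>\<^sup>2)" by simp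
  also have "\<dots> = 6 * \<epsilon> ^ 3 + 3 * \<epsilon> * E (\<lambda>k. q 1 k * h k) + 2 * \<epsilon>\<^sup>2 * E (q 2)"
    by (simp add: E_P E_h) (simp add: numeral_eq_Suc algebra_simps)
  finally show ?thesis .
qed

text \<open>The coefficients 6, 11, 6 come from expanding \<open>P 4\<close>. At second order in
  \<epsilon> the leftover \<open>- 3 * g * u ^ 2\<close> is completed to a square of favourable
  sign. The multiple of \<open>q 1\<close> this creates, for which only a bound of third order is at
  hand, cancels against the one in \<open>6 * \<epsilon> * E (h ^ 2)\<close>.\<close>

lemma E_h4: "E (\<lambda>k. h k ^ 4) = 24 * \<epsilon> ^ 4 + 6 * \<epsilon> * E (\<lambda>k. q 1 k * h k ^ 2)
   + 11 * \<epsilon>\<^sup>2 * E (\<lambda>k. q 2 k * h k) + 6 * \<epsilon> ^ 3 * E (q 3) - 3 * \<epsilon>\<^sup>2 * E (\<lambda>k. g k * (u k - 1) ^ 2)"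
proof -
  have eq: "(\<lambda>k. h k ^ 4) = (\<lambda>k. 1 - 4 * P 1 k + 6 * P 2 k - 4 * P 3 k + P 4 k
      + 6 * \<epsilon> * (q 1 k * h k ^ 2) + 6 * \<epsilon> * h k ^ 2
      + 11 * \<epsilon>\<^sup>2 * (q 2 k * h k) + 8 * \<epsilon>\<^sup>2 * h k - 3 * \<epsilon>\<^sup>2 * (g k * (u k - 1) ^ 2) - 6 * \<epsilon>\<^sup>2 * q 1 k
      - 3 * \<epsilon>\<^sup>2 + 6 * \<epsilon> ^ 3 * q 3 k + 6 * \<epsilon> ^ 3)"
    by (simp add: fun_eq_iff h_def P_def q_def numeral_eq_Suc algebra_simps)
  have "E (\<lambda>k. h k ^ 4) = E (\<lambda>k. 1 - 4 * P 1 k + 6 * P 2 k - 4 * P 3 k + P 4 k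
      + 6 * \<epsilon> * (q 1 k * h k ^ 2) + 6 * \<epsilon> * h k ^ 2
      + 11 * \<epsilon>\<^sup>2 * (q 2 k * h k) + 8 * \<epsilon>\<^sup>2 * h k - 3 * \<epsilon>\<^sup>2 * (g k * (u k - 1) ^ 2) - 6 * \<epsilon>\<^sup>2 * q 1 k
      - 3 * \<epsilon>\<^sup>2 + 6 * \<epsilon> ^ 3 * q 3 k + 6 * \<epsilon> ^ 3)" by (simp only: eq)
  also have "\<dots> = 24 * \<epsilon> ^ 4 + 6 * \<epsilon> * E (\<lambda>k. q 1 k * h k ^ 2)
   + 11 * \<epsilon>\<^sup>2 * E (\<lambda>k. q 2 k * h k) + 6 * \<epsilon> ^ 3 * E (q 3) - 3 * \<epsilon>\<^sup>2 * E (\<lambda>k. g k * (u k - 1) ^ 2)"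
    by (simp add: E_P E_h E_h2) (simp add: numeral_eq_Suc algebra_simps)
  finally show ?thesis .
qed

section \<open>Pointwise bounds in the rescaled size\<close>

lemma q_le:
  assumes k: "k \<in> {1..n}"
  shows "q j k \<le> real j * 3 ^ j * x k"
proof -
  have "g k * u k ^ j = (1 - x k) * u k ^ Suc j" by (simp add: g_def)
  \<comment> \<open>The factor \<open>1 - x k <= exp (- x k)\<close> cancels one of the
    \<open>j + 1\<close> exponentials, each at most \<open>exp (x k)\<close> because
    \<open>t < 1\<close>.\<close>
  also have "\<dots> \<le> exp (- x k) * exp (x k) ^ Suc j"
    using x_bounds[OF k] t exp_ge_add_one_self[of "- x k"]
    by (intro mult_mono power_mono) (auto simp: u_def mult_left_le_one_le)
  also have "\<dots> = exp (x k) ^ j"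
    by (simp add: exp_minus)
  also have "\<dots> = exp (real j * x k)"
    by (simp add: exp_of_nat_mult)
  also have "\<dots> \<le> 1 + real j * x k * exp (real j * x k)"
    by (rule exp_le_linear)
  also have "\<dots> \<le> 1 + real j * x k * 3 ^ j"
  proof -
    have "exp (real j * x k) \<le> exp 1 ^ j"
      using x_bounds[OF k] by (simp add: mult_left_le flip: exp_of_nat_mult)
    also have "exp 1 ^ j \<le> (3::real) ^ j"
      using exp_le by (intro power_mono) auto
    finally show ?thesis
      using x_bounds[OF k] by (intro add_left_mono mult_left_mono) auto
  qed
  finally show ?thesis
    by (simp add: q_def mult_ac)
qed

text \<open>Second-order Taylor expansion of \<open>1 - (1 - x) * exp (t * x)\<close> at 0. The
  remainder is a difference of two quantities in \<open>[0, x ^ 3 / 2]\<close>.\<close>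

lemma h_expand:
  assumes k: "k \<in> {1..n}"
  shows "\<bar>h k - s * x k - (t - t\<^sup>2 / 2) * x k ^ 2\<bar> \<le> x k ^ 3"
proof -
  define r where "r = u k - (1 + t * x k + (t * x k)\<^sup>2 / 2)"
  have tx: "0 \<le> t * x k" "t * x k \<le> x k" "t * x k \<le> 1"
    using x_bounds[OF k] t by (auto simp: mult_left_le_one_le mult_le_one)
  have r: "0 \<le> r" "r \<le> x k ^ 3 / 2"
    using exp_lower_Taylor_quadratic[OF tx(1)] exp_le_cubic[OF tx(1,3)] power_mono[OF tx(2,1), of 3]
    by (auto simp: r_def u_def)
  have "h k - s * x k - (t - t\<^sup>2 / 2) * x k ^ 2 = t\<^sup>2 * x k ^ 3 / 2 - (1 - x k) * r"
    by (simp add: h_def g_def s_def r_def field_simps power2_eq_square power3_eq_cube)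
  moreover have "0 \<le> t\<^sup>2 * x k ^ 3" "t\<^sup>2 * x k ^ 3 \<le> x k ^ 3" "0 \<le> (1 - x k) * r" "(1 - x k) * r \<le> r"
    using x_bounds[OF k] t r by (auto simp: mult_left_le_one_le power_le_one)
  ultimately show ?thesis using r by linarith
qed

text \<open>Since \<open>s + t = 1\<close>, \<open>1 - x <= (1 - s * x) * (1 - t * x)\<close>, and
  the last factor is at most \<open>exp (- t * x)\<close>; hence \<open>g <= 1 - s * x\<close>. All
  moment bounds rest on this inequality.\<close>

lemma h_ge:
  assumes k: "k \<in> {1..n}"
  shows "s * x k \<le> h k"
proof -
  have tx: "t * x k < 1" using x_bounds[OF k] t by (metis mult_less_cancel_right2 mult.commute le_less_trans mult_left_le)
  have "(1 - x k) \<le> (1 - s * x k) * (1 - t * x k)"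
  proof -
    have "(1 - s * x k) * (1 - t * x k) - (1 - x k) = s * t * x k ^ 2"
      by (simp add: s_def algebra_simps power2_eq_square)
    moreover have "0 \<le> s * t * x k ^ 2" using s_bounds t by simp
    ultimately show ?thesis by linarith
  qed
  also have "\<dots> \<le> (1 - s * x k) * exp (- (t * x k))"
    using exp_ge_add_one_self[of "- (t * x k)"] x_bounds[OF k] s_bounds
    by (intro mult_left_mono) (auto simp: mult_le_one)
  finally have "g k \<le> (1 - s * x k) * exp (- (t * x k)) * u k"
    unfolding g_def by (rule mult_right_mono) (simp add: u_def)
  then show ?thesis by (simp add: h_def u_def mult.assoc flip: exp_add)
qed

lemma h_le:
  assumes k: "k \<in> {1..n}"
  shows "h k \<le> s * x k + 2 * x k ^ 2"
proof -
  have "(t - t\<^sup>2 / 2) * x k ^ 2 \<le> 1 * x k ^ 2"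
    using t zero_le_power2[of t] by (intro mult_right_mono) (linarith, simp)
  moreover have "x k ^ 3 \<le> x k ^ 2" using x_bounds[OF k] by (intro power_decreasing) auto
  ultimately show ?thesis using h_expand[OF k] by linarith
qed

text \<open>Here \<open>g * u = (1 - x) * exp (2 * t * x)\<close> has linear coefficient
  \<open>2 * t - 1\<close>. The constant 36 is \<open>2 ^ 2 * 9\<close>, from
  \<open>2 * t * x <= 2 * x\<close> and \<open>exp 2 <= 9\<close>.\<close>

lemma q1_expand:
  assumes k: "k \<in> {1..n}"
  shows "\<bar>q 1 k - (2 * t - 1) * x k\<bar> \<le> 36 * x k ^ 2"
proof -
  let ?y = "2 * t * x k"
  define r where "r = exp ?y - 1 - ?y"
  have y: "0 \<le> ?y" "?y \<le> 2 * x k" "?y \<le> 2"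
    using x_bounds[OF k] t by (auto simp: mult_left_le_one_le mult_le_one)
  have "exp ?y \<le> exp 1 ^ 2"
    using y by (simp flip: exp_of_nat_mult)
  also have "exp 1 ^ 2 \<le> (3::real) ^ 2"
    using exp_le by (intro power_mono) auto
  finally have "?y\<^sup>2 * exp ?y \<le> (2 * x k)\<^sup>2 * 9"
    using y t by (intro mult_mono power_mono) auto
  also have "(2 * x k)\<^sup>2 * 9 = 36 * x k ^ 2" by (simp add: power2_eq_square)
  finally have r: "0 \<le> r" "r \<le> 36 * x k ^ 2"
    unfolding r_def using exp_ge_add_one_self[of ?y] exp_le_quadratic[OF y(1)]
    by linarith+
  have "q 1 k = (1 - x k) * exp ?y - 1"
    by (simp add: q_def g_def u_def flip: exp_add)
  then have "q 1 k - (2 * t - 1) * x k = (1 - x k) * r - 2 * t * x k ^ 2"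
    by (simp add: r_def algebra_simps power2_eq_square)
  moreover have "0 \<le> t * x k ^ 2" "t * x k ^ 2 \<le> x k ^ 2" "0 \<le> (1 - x k) * r" "(1 - x k) * r \<le> r"
    using x_bounds[OF k] t r by (auto simp: mult_left_le_one_le)
  ultimately show ?thesis using r by linarith
qed


section \<open>Moment bounds by bootstrapping\<close>

abbreviation "\<mu> j \<equiv> E (\<lambda>k. x k ^ j)"

lemma E_q_mult_le:
  assumes "\<And>k. k \<in> {1..n} \<Longrightarrow> 0 \<le> f k"
  shows "E (\<lambda>k. q j k * f k) \<le> real j * 3 ^ j * E (\<lambda>k. x k * f k)"
proof -
  have "E (\<lambda>k. q j k * f k) \<le> E (\<lambda>k. real j * 3 ^ j * (x k * f k))"
    using mult_right_mono[OF q_le assms] by (intro E_mono) (simp add: mult_ac)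
  then show ?thesis by simp
qed

lemma E_q_le: "E (q j) \<le> real j * 3 ^ j * E x"
  using E_q_mult_le[of "\<lambda>_. 1" j] by simp

lemma h_nonneg: "k \<in> {1..n} \<Longrightarrow> 0 \<le> h k"
  using h_ge[of k] x_bounds[of k] s_bounds by (auto intro: order_trans[rotated])

text \<open>Trades a factor \<open>x\<close> for \<open>h\<close> at the price \<open>1 / s\<close>.
  With \<open>f\<close> a power of \<open>h\<close>, it bounds the corrections in
  \<open>E_h3\<close> and \<open>E_h4\<close> by lower moments of \<open>h\<close> that are already
  controlled.\<close>

lemma E_x_mult_le:
  assumes "\<And>k. k \<in> {1..n} \<Longrightarrow> 0 \<le> f k"
  shows "E (\<lambda>k. x k * f k) \<le> E (\<lambda>k. h k * f k) / s"
proof -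
  have "E (\<lambda>k. s * (x k * f k)) \<le> E (\<lambda>k. h k * f k)"
    using mult_right_mono[OF h_ge assms] by (intro E_mono) (simp add: mult_ac)
  then show ?thesis using s_bounds by (simp add: field_simps)
qed

lemma \<mu>_le: "\<mu> j \<le> E (\<lambda>k. h k ^ j) / s ^ j"
proof -
  have "E (\<lambda>k. s ^ j * x k ^ j) \<le> E (\<lambda>k. h k ^ j)"
    using power_mono[OF h_ge] x_bounds s_bounds by (intro E_mono) (simp add: power_mult_distrib)
  then show ?thesis using s_bounds by (simp add: field_simps)
qed

lemma divide_s_mono:
  assumes "0 \<le> c" "i \<le> j"
  shows "c / s ^ i \<le> c / s ^ j"
  using assms s_bounds by (intro divide_left_mono power_decreasing) auto

lemma E_x_le: "E x \<le> \<epsilon> / s"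
  using \<mu>_le[of 1] by (simp add: E_h)

lemma E_h2_le: "E (\<lambda>k. h k ^ 2) \<le> 5 * \<epsilon>\<^sup>2 / s"
proof -
  have "\<epsilon> * E (q 1) \<le> \<epsilon> * (3 * (\<epsilon> / s))"
    using E_q_le[of 1] E_x_le \<epsilon>_bounds by (intro mult_left_mono) auto
  moreover have "2 * \<epsilon>\<^sup>2 \<le> 2 * \<epsilon>\<^sup>2 / s"
    using divide_s_mono[of "2 * \<epsilon>\<^sup>2" 0 1] by simp
  ultimately show ?thesis unfolding E_h2 by (simp add: power2_eq_square)
qed

lemma E_xh_le: "E (\<lambda>k. x k * h k) \<le> 5 * \<epsilon>\<^sup>2 / s\<^sup>2"
proof -
  have "E (\<lambda>k. x k * h k) \<le> E (\<lambda>k. h k ^ 2) / s"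
    using E_x_mult_le[of h] h_nonneg by (simp add: power2_eq_square)
  also have "\<dots> \<le> 5 * \<epsilon>\<^sup>2 / s / s"
    using E_h2_le s_bounds by (intro divide_right_mono) auto
  finally show ?thesis by (simp add: power2_eq_square)
qed

lemma E_h3_le: "E (\<lambda>k. h k ^ 3) \<le> 87 * \<epsilon> ^ 3 / s\<^sup>2"
proof -
  have "3 * \<epsilon> * E (\<lambda>k. q 1 k * h k) \<le> 3 * \<epsilon> * (3 * (5 * \<epsilon>\<^sup>2 / s\<^sup>2))"
    using E_q_mult_le[of h 1] h_nonneg E_xh_le \<epsilon>_bounds by (intro mult_left_mono) auto
  moreover have "2 * \<epsilon>\<^sup>2 * E (q 2) \<le> 2 * \<epsilon>\<^sup>2 * (18 * (\<epsilon> / s))"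
    using E_q_le[of 2] E_x_le \<epsilon>_bounds by (intro mult_left_mono) auto
  moreover have "36 * \<epsilon> ^ 3 / s \<le> 36 * \<epsilon> ^ 3 / s\<^sup>2" "6 * \<epsilon> ^ 3 \<le> 6 * \<epsilon> ^ 3 / s\<^sup>2"
    using divide_s_mono[of "36 * \<epsilon> ^ 3" 1 2] divide_s_mono[of "6 * \<epsilon> ^ 3" 0 2] \<epsilon>_bounds by auto
  ultimately show ?thesis unfolding E_h3 by (simp add: power2_eq_square power3_eq_cube)
qed

text \<open>The terms of \<open>E_h4\<close> contribute \<open>6 * 3 * 87 = 1566\<close>,
  \<open>11 * 18 * 5 = 990\<close>, \<open>6 * 81 = 486\<close> and 24, each with at most three
  powers of \<open>1 / s\<close>; the subtracted square term is dropped.\<close>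

lemma E_h4_le: "E (\<lambda>k. h k ^ 4) \<le> 3066 * \<epsilon> ^ 4 / s ^ 3"
proof -
  have "E (\<lambda>k. x k * h k ^ 2) \<le> E (\<lambda>k. h k ^ 3) / s"
    using E_x_mult_le[of "\<lambda>k. h k ^ 2"] by (simp add: numeral_eq_Suc)
  also have "\<dots> \<le> 87 * \<epsilon> ^ 3 / s\<^sup>2 / s"
    using E_h3_le s_bounds by (intro divide_right_mono) auto
  finally have xh2: "E (\<lambda>k. x k * h k ^ 2) \<le> 87 * \<epsilon> ^ 3 / s ^ 3"
    by (simp add: power2_eq_square power3_eq_cube)
  have "6 * \<epsilon> * E (\<lambda>k. q 1 k * h k ^ 2) \<le> 6 * \<epsilon> * (3 * (87 * \<epsilon> ^ 3 / s ^ 3))"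
    using E_q_mult_le[of "\<lambda>k. h k ^ 2" 1] xh2 \<epsilon>_bounds by (intro mult_left_mono) auto
  moreover have "11 * \<epsilon>\<^sup>2 * E (\<lambda>k. q 2 k * h k) \<le> 11 * \<epsilon>\<^sup>2 * (18 * (5 * \<epsilon>\<^sup>2 / s\<^sup>2))"
    using E_q_mult_le[of h 2] h_nonneg E_xh_le \<epsilon>_bounds by (intro mult_left_mono) auto
  moreover have "6 * \<epsilon> ^ 3 * E (q 3) \<le> 6 * \<epsilon> ^ 3 * (81 * (\<epsilon> / s))"
    using E_q_le[of 3] E_x_le \<epsilon>_bounds by (intro mult_left_mono) auto
  moreover have "0 \<le> 3 * \<epsilon>\<^sup>2 * E (\<lambda>k. g k * (u k - 1) ^ 2)"
    using x_bounds by (intro mult_nonneg_nonneg E_nonneg) (auto simp: g_def u_def)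
  moreover have "990 * \<epsilon> ^ 4 / s\<^sup>2 \<le> 990 * \<epsilon> ^ 4 / s ^ 3" "486 * \<epsilon> ^ 4 / s \<le> 486 * \<epsilon> ^ 4 / s ^ 3"
    "24 * \<epsilon> ^ 4 \<le> 24 * \<epsilon> ^ 4 / s ^ 3"
    using divide_s_mono[of "990 * \<epsilon> ^ 4" 2 3] divide_s_mono[of "486 * \<epsilon> ^ 4" 1 3]
      divide_s_mono[of "24 * \<epsilon> ^ 4" 0 3] by auto
  ultimately show ?thesis unfolding E_h4 by (simp add: numeral_eq_Suc)
qed

lemma \<mu>2_le: "\<mu> 2 \<le> 5 * \<epsilon>\<^sup>2 / s ^ 3"
proof -
  have "\<mu> 2 \<le> 5 * \<epsilon>\<^sup>2 / s / s\<^sup>2"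
    using s_bounds by (intro order_trans[OF \<mu>_le] divide_right_mono E_h2_le) auto
  then show ?thesis by (simp flip: power_Suc)
qed

lemma \<mu>3_le: "\<mu> 3 \<le> 87 * \<epsilon> ^ 3 / s ^ 5"
proof -
  have "\<mu> 3 \<le> 87 * \<epsilon> ^ 3 / s\<^sup>2 / s ^ 3"
    using s_bounds by (intro order_trans[OF \<mu>_le] divide_right_mono E_h3_le) auto
  then show ?thesis by (simp flip: power_add)
qed

lemma \<mu>4_le: "\<mu> 4 \<le> 3066 * \<epsilon> ^ 4 / s ^ 7"
proof -
  have "\<mu> 4 \<le> 3066 * \<epsilon> ^ 4 / s ^ 3 / s ^ 4"
    using s_bounds by (intro order_trans[OF \<mu>_le] divide_right_mono E_h4_le) auto
  then show ?thesis by (simp flip: power_add)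
qed

lemma abs_E_le:
  fixes f f' :: "nat \<Rightarrow> real"
  assumes "\<And>k. k \<in> {1..n} \<Longrightarrow> \<bar>f k\<bar> \<le> f' k"
  shows "\<bar>E f\<bar> \<le> E f'"
proof -
  have "E f \<le> E f'" "E (\<lambda>k. - f k) \<le> E f'"
    using assms by (intro E_mono; auto simp: abs_le_iff)+
  then show ?thesis by (simp add: abs_le_iff)
qed

section \<open>Approximate linear equations for the first two moments\<close>

lemma first_moment_equation: "\<bar>\<epsilon> - s * E x - (t - t\<^sup>2 / 2) * \<mu> 2\<bar> \<le> \<mu> 3"
  using abs_E_le[of "\<lambda>k. h k - s * x k - (t - t\<^sup>2 / 2) * x k ^ 2" "\<lambda>k. x k ^ 3"] h_expand
  by (simp add: E_h)

text \<open>Two evaluations of \<open>E (h ^ 2)\<close> are compared: the exact identity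
  \<open>E_h2\<close> with \<open>q 1\<close> linearised, and \<open>s\<^sup>2 * \<mu> 2\<close>,
  whose error comes from squeezing \<open>h\<close> between \<open>s * x\<close> and
  \<open>s * x + 2 * x ^ 2\<close>.\<close>

lemma second_moment_equation:
  "\<bar>s\<^sup>2 * \<mu> 2 - 2 * \<epsilon>\<^sup>2 - (2 * t - 1) * \<epsilon> * E x\<bar> \<le> 36 * \<epsilon> * \<mu> 2 + 4 * s * \<mu> 3 + 4 * \<mu> 4"
proof -
  have "\<bar>h k ^ 2 - s\<^sup>2 * x k ^ 2\<bar> \<le> 4 * s * x k ^ 3 + 4 * x k ^ 4" if k: "k \<in> {1..n}" for k
  proof -
    have "h k ^ 2 \<le> (s * x k + 2 * x k ^ 2)\<^sup>2"
      using h_le[OF k] h_nonneg[OF k] by (intro power_mono)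
    also have "\<dots> = s\<^sup>2 * x k ^ 2 + (4 * s * x k ^ 3 + 4 * x k ^ 4)"
      by (simp add: numeral_eq_Suc algebra_simps)
    moreover have "(s * x k)\<^sup>2 \<le> h k ^ 2"
      using h_ge[OF k] s_bounds x_bounds[OF k] by (intro power_mono) auto
    ultimately show ?thesis by (simp add: power_mult_distrib)
  qed
  then have "\<bar>E (\<lambda>k. h k ^ 2 - s\<^sup>2 * x k ^ 2)\<bar> \<le> E (\<lambda>k. 4 * s * x k ^ 3 + 4 * x k ^ 4)"
    by (rule abs_E_le)
  then have "\<bar>2 * \<epsilon>\<^sup>2 + \<epsilon> * E (q 1) - s\<^sup>2 * \<mu> 2\<bar> \<le> 4 * s * \<mu> 3 + 4 * \<mu> 4"
    by (simp add: E_h2)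
  moreover have "\<bar>E (q 1) - (2 * t - 1) * E x\<bar> \<le> 36 * \<mu> 2"
    using abs_E_le[of "\<lambda>k. q 1 k - (2 * t - 1) * x k" "\<lambda>k. 36 * x k ^ 2"] q1_expand by simp
  then have "\<epsilon> * \<bar>E (q 1) - (2 * t - 1) * E x\<bar> \<le> \<epsilon> * (36 * \<mu> 2)"
    using \<epsilon>_bounds by (intro mult_left_mono) auto
  then have "\<bar>\<epsilon> * (E (q 1) - (2 * t - 1) * E x)\<bar> \<le> \<epsilon> * (36 * \<mu> 2)"
    using \<epsilon>_bounds by (simp add: abs_mult)
  ultimately show ?thesis by (simp add: algebra_simps)
qed


section \<open>Solving for the mean and the second moment\<close>

abbreviation "m j \<equiv> E (\<lambda>k. real k ^ j)"

lemma \<mu>_eq: "\<mu> j = \<epsilon> ^ j * m j"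
  by (simp add: x_def \<epsilon>_def power_divide)

text \<open>The hypothesis allows each excess factor \<open>\<epsilon> / s ^ 3\<close> to be bounded
  by 1. Then \<open>eq1\<close> gives \<open>m 1\<close> to leading order, \<open>eq2\<close> gives
  \<open>m 2\<close>, and returning to \<open>eq1\<close> yields the next term of
  \<open>m 1\<close>.\<close>

lemma component_size_asymptotics:
  assumes \<epsilon>s: "\<epsilon> \<le> s ^ 3"
  shows "\<bar>m 1 - 1 / s - (t\<^sup>2 / 2 - t) / s ^ 4 * \<epsilon>\<bar> \<le> 12882 * \<epsilon>\<^sup>2 / s ^ 7"
    and "\<bar>m 2 - 1 / s ^ 3\<bar> \<le> 12882 * \<epsilon> / s ^ 6"
proof -
  define c where "c = t - t\<^sup>2 / 2"
  have c: "0 \<le> c" "c \<le> 1 / 2"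
  proof -
    have "c = 1 / 2 - (1 - t)\<^sup>2 / 2" by (simp add: c_def power2_eq_square field_simps)
    moreover have "(1 - t)\<^sup>2 \<le> 1" using t by (intro power_le_one) auto
    ultimately show "0 \<le> c" "c \<le> 1 / 2" using zero_le_power2[of "1 - t"] by linarith+
  qed
  have eps2: "\<epsilon>\<^sup>2 / s ^ (j + 3) \<le> \<epsilon> / s ^ j" for j
  proof -
    have "\<epsilon> * \<epsilon> / s ^ (j + 3) \<le> \<epsilon> * s ^ 3 / s ^ (j + 3)"
      using \<epsilon>s \<epsilon>_bounds s_bounds by (intro divide_right_mono mult_left_mono) auto
    then show ?thesis using s_bounds by (simp add: power_add power2_eq_square)
  qed
  have \<mu>1: "E x = \<epsilon> * m 1" using \<mu>_eq[of 1] by simp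
  have m2: "0 \<le> m 2" "m 2 \<le> 5 / s ^ 3"
  proof -
    have "\<epsilon>\<^sup>2 * m 2 \<le> \<epsilon>\<^sup>2 * (5 / s ^ 3)" using \<mu>2_le \<mu>_eq[of 2] by (simp add: mult.commute)
    then show "m 2 \<le> 5 / s ^ 3" using \<epsilon>_bounds by (simp only: mult_le_cancel_left_pos zero_less_power)
  qed (auto intro: E_nonneg)
  have eq1: "\<bar>1 - s * m 1 - c * \<epsilon> * m 2\<bar> \<le> 87 * \<epsilon>\<^sup>2 / s ^ 5"
  proof -
    have "\<epsilon> * \<bar>1 - s * m 1 - c * \<epsilon> * m 2\<bar> = \<bar>\<epsilon> * (1 - s * m 1 - c * \<epsilon> * m 2)\<bar>"
      using \<epsilon>_bounds by (simp add: abs_mult)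
    also have "\<dots> = \<bar>\<epsilon> - s * E x - c * \<mu> 2\<bar>"
      unfolding \<mu>1 \<mu>_eq[of 2] by (simp add: algebra_simps power2_eq_square)
    also have "\<dots> \<le> \<epsilon> * (87 * \<epsilon>\<^sup>2 / s ^ 5)"
      using first_moment_equation \<mu>3_le by (simp add: c_def power2_eq_square power3_eq_cube mult_ac)
    finally show ?thesis using \<epsilon>_bounds by (simp only: mult_le_cancel_left_pos)
  qed
  have eq2: "\<bar>s\<^sup>2 * m 2 - 2 - (2 * t - 1) * m 1\<bar> \<le> 12792 * \<epsilon> / s ^ 4"
  proof -
    have "\<epsilon>\<^sup>2 * \<bar>s\<^sup>2 * m 2 - 2 - (2 * t - 1) * m 1\<bar> = \<bar>\<epsilon>\<^sup>2 * (s\<^sup>2 * m 2 - 2 - (2 * t - 1) * m 1)\<bar>"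
      by (simp add: abs_mult)
    also have "\<dots> = \<bar>s\<^sup>2 * \<mu> 2 - 2 * \<epsilon>\<^sup>2 - (2 * t - 1) * \<epsilon> * E x\<bar>"
      unfolding \<mu>1 \<mu>_eq[of 2] by (simp add: algebra_simps power2_eq_square)
    also have "\<dots> \<le> 36 * \<epsilon> * (5 * \<epsilon>\<^sup>2 / s ^ 3) + 4 * s * (87 * \<epsilon> ^ 3 / s ^ 5) + 4 * (3066 * \<epsilon> ^ 4 / s ^ 7)"
      using \<epsilon>_bounds s_bounds by (intro order_trans[OF second_moment_equation] add_mono mult_left_mono \<mu>2_le \<mu>3_le \<mu>4_le) auto
    also have "\<dots> = \<epsilon>\<^sup>2 * (180 * (\<epsilon> / s ^ 3) + 348 * (\<epsilon> / s ^ 4) + 12264 * (\<epsilon>\<^sup>2 / s ^ 7))"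
      using s_bounds by (simp add: numeral_eq_Suc field_simps)
    finally have "\<bar>s\<^sup>2 * m 2 - 2 - (2 * t - 1) * m 1\<bar> \<le>
        180 * (\<epsilon> / s ^ 3) + 348 * (\<epsilon> / s ^ 4) + 12264 * (\<epsilon>\<^sup>2 / s ^ 7)"
      using \<epsilon>_bounds by (simp only: mult_le_cancel_left_pos zero_less_power)
    moreover have "\<epsilon> / s ^ 3 \<le> \<epsilon> / s ^ 4" using divide_s_mono[of \<epsilon> 3 4] \<epsilon>_bounds by simp
    moreover have "\<epsilon>\<^sup>2 / s ^ 7 \<le> \<epsilon> / s ^ 4" using eps2[of 4] by simp
    ultimately show ?thesis by simp
  qed
  \<comment> \<open>For the leading order, \<open>m 2 <= 5 / s ^ 3\<close> suffices; 90 rounds up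
    \<open>87 + 5 / 2\<close>.\<close>
  have m1: "\<bar>m 1 - 1 / s\<bar> \<le> 90 * \<epsilon> / s ^ 4"
  proof -
    have "c * \<epsilon> * m 2 \<le> 1 / 2 * \<epsilon> * (5 / s ^ 3)"
      using c m2 \<epsilon>_bounds s_bounds by (intro mult_mono) auto
    moreover have "\<epsilon>\<^sup>2 / s ^ 5 \<le> \<epsilon> / s ^ 2" using eps2[of 2] by simp
    moreover have "\<epsilon> / s ^ 2 \<le> \<epsilon> / s ^ 3" using divide_s_mono[of \<epsilon> 2 3] \<epsilon>_bounds by simp
    moreover have "0 \<le> c * \<epsilon> * m 2" "0 \<le> \<epsilon> / s ^ 3" using c \<epsilon>_bounds m2 s_bounds by auto
    ultimately have "\<bar>s * m 1 - 1\<bar> \<le> 90 * (\<epsilon> / s ^ 3)"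
      using eq1 unfolding abs_le_iff by simp
    then have "\<bar>s * m 1 - 1\<bar> / s \<le> 90 * (\<epsilon> / s ^ 3) / s"
      using s_bounds by (intro divide_right_mono) auto
    moreover have "\<bar>s * m 1 - 1\<bar> / s = \<bar>m 1 - 1 / s\<bar>"
    proof -
      have "m 1 - 1 / s = (s * m 1 - 1) / s" using s_bounds by (simp add: field_simps)
      then show ?thesis using s_bounds by (simp add: abs_divide)
    qed
    moreover have "90 * (\<epsilon> / s ^ 3) / s = 90 * \<epsilon> / s ^ 4" using s_bounds by (simp add: numeral_eq_Suc)
    ultimately show ?thesis by metis
  qed
  show 2: "\<bar>m 2 - 1 / s ^ 3\<bar> \<le> 12882 * \<epsilon> / s ^ 6"
  proof -
    \<comment> \<open>The main terms of \<open>eq2\<close> combine to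
      \<open>2 + (2 * t - 1) / s = 1 / s\<close>, whence \<open>1 / s ^ 3\<close> after division by
      \<open>s\<^sup>2\<close>. The error constant is \<open>12792 + 90\<close>.\<close>
    have "2 * t - 1 = 1 - 2 * s" by (simp add: s_def)
    then have "s\<^sup>2 * (m 2 - 1 / s ^ 3) = (s\<^sup>2 * m 2 - 2 - (2 * t - 1) * m 1) + (2 * t - 1) * (m 1 - 1 / s)"
      using s_bounds by (simp add: field_simps numeral_eq_Suc)
    moreover have "\<bar>(2 * t - 1) * (m 1 - 1 / s)\<bar> \<le> 1 * (90 * \<epsilon> / s ^ 4)"
      unfolding abs_mult using t m1 by (intro mult_mono) auto
    ultimately have "\<bar>s\<^sup>2 * (m 2 - 1 / s ^ 3)\<bar> \<le> 12792 * \<epsilon> / s ^ 4 + 1 * (90 * \<epsilon> / s ^ 4)"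
      using eq2 by (simp only: order_trans[OF abs_triangle_ineq add_mono])
    also have "\<dots> = 12882 * \<epsilon> / s ^ 4"
      by (simp flip: add_divide_distrib)
    finally have "\<bar>s\<^sup>2 * (m 2 - 1 / s ^ 3)\<bar> \<le> 12882 * \<epsilon> / s ^ 4" .
    then have "s\<^sup>2 * \<bar>m 2 - 1 / s ^ 3\<bar> \<le> s\<^sup>2 * (12882 * \<epsilon> / s ^ 6)"
      using s_bounds by (simp add: abs_mult numeral_eq_Suc)
    then show ?thesis using s_bounds by (simp only: mult_le_cancel_left_pos zero_less_power)
  qed
  show "\<bar>m 1 - 1 / s - (t\<^sup>2 / 2 - t) / s ^ 4 * \<epsilon>\<bar> \<le> 12882 * \<epsilon>\<^sup>2 / s ^ 7"
  proof -
    \<comment> \<open>Replacing \<open>m 2\<close> by \<open>1 / s ^ 3\<close> in \<open>eq1\<close>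
      and dividing by \<open>s\<close> produces the correction
      \<open>- c * \<epsilon> / s ^ 4\<close>. The error constant
      \<open>87 + 12882 / 2 = 6528\<close> is then relaxed so that one constant serves both
      bounds.\<close>
    have eq: "s * (m 1 - 1 / s - (t\<^sup>2 / 2 - t) / s ^ 4 * \<epsilon>) =
        - (1 - s * m 1 - c * \<epsilon> * m 2) - c * \<epsilon> * (m 2 - 1 / s ^ 3)" (is "_ = - ?a - ?b")
      using s_bounds by (simp add: c_def field_simps numeral_eq_Suc)
    have b: "\<bar>?b\<bar> \<le> 1 / 2 * \<epsilon> * (12882 * \<epsilon> / s ^ 6)"
      unfolding abs_mult using c \<epsilon>_bounds 2 by (intro mult_mono) auto
    have "\<bar>- ?a - ?b\<bar> \<le> \<bar>?a\<bar> + \<bar>?b\<bar>"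
      using abs_triangle_ineq4[of "- ?a" ?b] by (simp only: abs_minus_cancel)
    also have "\<dots> \<le> 87 * \<epsilon>\<^sup>2 / s ^ 6 + 1 / 2 * \<epsilon> * (12882 * \<epsilon> / s ^ 6)"
      using divide_s_mono[of "87 * \<epsilon>\<^sup>2" 5 6] by (intro add_mono b order_trans[OF eq1]) simp
    also have "\<dots> = 6528 * (\<epsilon>\<^sup>2 / s ^ 6)"
      by (simp add: power2_eq_square flip: add_divide_distrib)
    also have "\<dots> \<le> 12882 * (\<epsilon>\<^sup>2 / s ^ 6)"
      using s_bounds by (intro mult_right_mono) auto
    finally have "\<bar>s * (m 1 - 1 / s - (t\<^sup>2 / 2 - t) / s ^ 4 * \<epsilon>)\<bar> \<le> 12882 * (\<epsilon>\<^sup>2 / s ^ 6)"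
      unfolding eq .
    then have "s * \<bar>m 1 - 1 / s - (t\<^sup>2 / 2 - t) / s ^ 4 * \<epsilon>\<bar> \<le> s * (12882 * \<epsilon>\<^sup>2 / s ^ 7)"
      using s_bounds by (simp add: abs_mult numeral_eq_Suc)
    then show ?thesis using s_bounds by (simp only: mult_le_cancel_left_pos)
  qed
qed

end

section \<open>Application to the random graph\<close>

lemma component_size_law_erdos_renyi:
  assumes n: "n \<ge> 1" and t: "0 \<le> t" "t < 1"
  shows "component_size_law
    (map_pmf (\<lambda>E. card (component n E 1)) (erdos_renyi n (1 - exp (- t / real n)))) n t"
proof
  let ?p = "1 - exp (- t / real n)"
  have "card (component n E 1) \<in> {1..n}" for E
  proof -
    have "card (component n E 1) > 0"
      using self_in_component[of 1 n E] n by (auto simp: card_gt_0_iff)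
    moreover have "card (component n E 1) \<le> card {1..n}"
      by (intro card_mono component_subset) auto
    ultimately show ?thesis by auto
  qed
  then show "set_pmf (map_pmf (\<lambda>E. card (component n E 1)) (erdos_renyi n ?p)) \<subseteq> {1..n}"
    by auto
  fix j
  have "1 / (1 - ?p) ^ (j * k) = exp (t * real k / real n) ^ j" for k
    by (simp add: exp_minus power_inverse field_simps flip: exp_of_nat_mult)
  then have "real ((n - k) choose j) * exp (t * real k / real n) ^ j =
      real ((n - k) choose j) / (1 - ?p) ^ (j * k)" for k
    by (metis times_divide_eq_right mult.right_neutral)
  then show "measure_pmf.expectation (map_pmf (\<lambda>E. card (component n E 1)) (erdos_renyi n ?p))
      (\<lambda>k. real ((n - k) choose j) * exp (t * real k / real n) ^ j) = real ((n - 1) choose j)"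
    using expectation_erdos_renyi_choose[of n ?p j] n t
    by (simp only: integral_map_pmf) (simp add: divide_nonpos_nonneg)
qed (use assms in auto)

theorem theorem1p4:
  "\<exists>C::real. C > 0 \<and>
     (\<forall>n::nat. n \<ge> 1 \<longrightarrow>
       (\<forall>t::real. 0 \<le> t \<and> t \<le> 1 - real n powr (- (1 / 3)) \<longrightarrow>
         (let p = 1 - exp (- t / real n) in
           \<bar>measure_pmf.expectation (erdos_renyi n p) (\<lambda>E. real (card (component n E 1)))
              - 1 / (1 - t) - (t ^ 2 / 2 - t) / (1 - t) ^ 4 * (1 / real n)\<bar>
             \<le> C / ((1 - t) ^ 7 * real n ^ 2) \<and>
           \<bar>measure_pmf.expectation (erdos_renyi n p) (\<lambda>E. real (card (component n E 1)) ^ 2)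
              - 1 / (1 - t) ^ 3\<bar>
             \<le> C / ((1 - t) ^ 6 * real n))))"
proof (intro exI[of _ "12882 :: real"] conjI allI impI)
  fix n :: nat and t :: real
  assume n: "n \<ge> 1" and "0 \<le> t \<and> t \<le> 1 - real n powr (- (1 / 3))"
  then have t0: "0 \<le> t" and tn: "real n powr (- (1 / 3)) \<le> 1 - t" by auto
  have "0 < real n powr (- (1 / 3))" using n by simp
  with tn have t1: "t < 1" by linarith
  let ?M = "map_pmf (\<lambda>E. card (component n E 1)) (erdos_renyi n (1 - exp (- t / real n)))"
  interpret component_size_law ?M n t
    using n t0 t1 by (rule component_size_law_erdos_renyi)
  \<comment> \<open>Cubing the bound \<open>n powr (- (1 / 3)) <= 1 - t\<close> gives
    \<open>\<epsilon> <= s ^ 3\<close>; this is where the range of \<open>t\<close> enters.\<close>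
  have "\<epsilon> = (real n powr (- (1 / 3))) ^ 3"
    using n by (simp add: \<epsilon>_def powr_minus_divide flip: powr_numeral) (simp add: powr_powr powr_divide)
  also have "\<dots> \<le> s ^ 3"
    unfolding s_def using tn by (intro power_mono) auto
  finally show "let p = 1 - exp (- t / real n) in
      \<bar>measure_pmf.expectation (erdos_renyi n p) (\<lambda>E. real (card (component n E 1)))
        - 1 / (1 - t) - (t ^ 2 / 2 - t) / (1 - t) ^ 4 * (1 / real n)\<bar>
        \<le> 12882 / ((1 - t) ^ 7 * real n ^ 2) \<and>
      \<bar>measure_pmf.expectation (erdos_renyi n p) (\<lambda>E. real (card (component n E 1)) ^ 2)
        - 1 / (1 - t) ^ 3\<bar> \<le> 12882 / ((1 - t) ^ 6 * real n)"
    using component_size_asymptotics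
    by (simp add: Let_def \<epsilon>_def s_def power_divide mult.commute)
qed simp

end
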